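(* Each of the following seven categories of infinite Collatz sequences with first term a well-determined (finite) positive integer is empty: $R[S^-A_0^-B^+]$, $R[S^-A_1^-B^-]$, $R[S^+A_1^-B^-]$, $R[S^-A_1^-B^+]$, $R[S^-A^+B^-]$, $R[S^-A^+B^+]$, $R[S^+A^+B^-]$. Explicitly, there is no positive integer $P$ such that $A_\infty(P)$ and $B_\infty(P)$ are defined and one of the following holds: (1) $A_\infty(P)=0$, $B_\infty(P)=+\infty$ and $T^\infty(P)\le T(P)$; (2) $0<A_\infty(P)<1$, $B_\infty(P)$ is finite and $T^\infty(P)\le T(P)$; (3) $0<A_\infty(P)<1$, $B_\infty(P)$ is finite and $T^\infty(P)>T(P)$; (4) $0<A_\infty(P)<1$, $B_\infty(P)=+\infty$ and $T^\infty(P)\le T(P)$; (5) $A_\infty(P)>1$ (possibly $+\infty$), $B_\infty(P)$ is finite and $T^\infty(P)\le T(P)$; (6) $A_\infty(P)>1$ (possibly $+\infty$), $B_\infty(P)=+\infty$ and $T^\infty(P)\le T(P)$; (7) $A_\infty(P)>1$ (possibly $+\infty$), $B_\infty(P)$ is finite and $T^\infty(P)>T(P)$.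
   Context: The Collatz map $T:\mathbb{N}^*\to\mathbb{N}^*$ on positive integers is $T(N)=\frac{3^{i_0(N)}}{2}N+\frac12 i_0(N)$, where $i_0(N)=1$ if $N$ is odd and $0$ if $N$ is even (so $T(N)=N/2$ for $N$ even and $(3N+1)/2$ for $N$ odd). $T^n$ denotes the $n$-th iterate. For $P\ge 1$ and $n\ge 0$ the iteration gives $T^n(P)=A_n(P)\,P+B_n(P)$, where $A_n(P)=3^{m}/2^n$ with $m$ the number of odd integers among $P,T(P),\dots,T^{n-1}(P)$, and $B_n(P)=T^n(P)-A_n(P)P$; equivalently $A_0=1$, $B_0=0$, $A_{n+1}(P)=\frac{3^{i}}{2}A_n(P)$, $B_{n+1}(P)=\frac{3^{i}}{2}B_n(P)+\frac{i}{2}$ with $i=i_0(T^n(P))$. Absolute coefficients of the infinite Collatz sequence of $P$: $A_\infty(P)=\lim_{n\to\infty}A_n(P)\in[0,+\infty]$ (when this limit exists). $B_\infty(P)=+\infty$ if $B_n(P)\to+\infty$; if instead there is $k\ge1$ such that for each residue class $j$ mod $k$ the sequence $B_n(P)$ restricted to $n\equiv j \pmod k$ converges to a finite limit, then $B_\infty(P)$ is the minimum of these $k$ limits. $T^\infty(P)=A_\infty(P)\,P+B_\infty(P)$, with the usual conventions in $[0,+\infty]$. Types: $R$ (realizable) means that the first term $P$ is a well-determined finite positive integer; $A_0^-$ means $A_\infty(P)=0$; $A_1^-$ means $0<A_\infty(P)<1$; $A^+$ means $A_\infty(P)>1$ (including $+\infty$); $B^-$ means $B_\infty(P)$ finite;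 $B^+$ means $B_\infty(P)=+\infty$; $S^-$ means $T^\infty(P)\le T(P)$; $S^+$ means $T^\infty(P)>T(P)$. *)

theory Defs
  imports "HOL-Analysis.Analysis"
begin

definition i0 :: "nat \<Rightarrow> nat"
  where "i0 N = (if odd N then 1 else 0)"

text \<open>The division is exact, see \<open>real_collatz\<close>. The map is meant on positive integers;
  positivity of the first term is assumed wherever it matters.\<close>

definition collatz :: "nat \<Rightarrow> nat"
  where "collatz N = (3 ^ i0 N * N + i0 N) div 2"

lemma real_collatz: "real (collatz N) = 3 ^ i0 N / 2 * real N + 1 / 2 * real (i0 N)"
proof -
  have "even (3 ^ i0 N * N + i0 N)"
    by (simp add: i0_def)
  then have "2 * collatz N = 3 ^ i0 N * N + i0 N"
    by (simp add: collatz_def)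
  then have "2 * real (collatz N) = 3 ^ i0 N * real N + real (i0 N)"
    by (metis of_nat_add of_nat_mult of_nat_numeral of_nat_power)
  then show ?thesis
    by simp
qed

text \<open>Odd terms among \<open>P, T(P), \<dots>, T^(n-1)(P)\<close> are counted with multiplicity, i.e. by index.\<close>

definition coeff_A :: "nat \<Rightarrow> nat \<Rightarrow> real"
  where "coeff_A P n = 3 ^ card {j. j < n \<and> odd ((collatz ^^ j) P)} / 2 ^ n"

definition coeff_B :: "nat \<Rightarrow> nat \<Rightarrow> real"
  where "coeff_B P n = real ((collatz ^^ n) P) - coeff_A P n * real P"

lemma coeff_0: "coeff_A P 0 = 1" "coeff_B P 0 = 0"
  by (simp_all add: coeff_A_def coeff_B_def)

lemma coeff_A_Suc: "coeff_A P (Suc n) = 3 ^ i0 ((collatz ^^ n) P) / 2 * coeff_A P n"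
proof -
  have "{j. j < Suc n \<and> odd ((collatz ^^ j) P)} =
      (if odd ((collatz ^^ n) P) then insert n {j. j < n \<and> odd ((collatz ^^ j) P)}
       else {j. j < n \<and> odd ((collatz ^^ j) P)})"
    by (auto simp: less_Suc_eq)
  then show ?thesis
    by (simp add: coeff_A_def i0_def)
qed

lemma coeff_B_Suc:
  "coeff_B P (Suc n) =
    3 ^ i0 ((collatz ^^ n) P) / 2 * coeff_B P n + real (i0 ((collatz ^^ n) P)) / 2"
proof -
  define x where "x = real ((collatz ^^ n) P)"
  define c :: real where "c = 3 ^ i0 ((collatz ^^ n) P)"
  define i where "i = real (i0 ((collatz ^^ n) P))"
  have "coeff_B P (Suc n) = (c / 2 * x + 1 / 2 * i) - c / 2 * coeff_A P n * real P"
    by (simp add: coeff_B_def coeff_A_Suc real_collatz x_def c_def i_def)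
  also have "\<dots> = c / 2 * (x - coeff_A P n * real P) + i / 2"
    by (simp add: right_diff_distrib mult.assoc)
  finally show ?thesis
    by (simp add: coeff_B_def x_def c_def i_def)
qed

definition A_infty_defined :: "nat \<Rightarrow> bool"
  where "A_infty_defined P \<longleftrightarrow> convergent (\<lambda>n. ereal (coeff_A P n))"

definition A_infty :: "nat \<Rightarrow> ereal"
  where "A_infty P = lim (\<lambda>n. ereal (coeff_A P n))"

definition has_residue_limits :: "(nat \<Rightarrow> real) \<Rightarrow> nat \<Rightarrow> (nat \<Rightarrow> real) \<Rightarrow> bool"
  where "has_residue_limits X k l \<longleftrightarrow> k \<ge> 1 \<and> (\<forall>j<k. (\<lambda>m. X (j + m * k)) \<longlonglongrightarrow> l j)"

definition has_B_infty :: "nat \<Rightarrow> ereal \<Rightarrow> bool"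
  where "has_B_infty P b \<longleftrightarrow>
    (filterlim (coeff_B P) at_top sequentially \<and> b = \<infinity>) \<or>
    (\<exists>k l. has_residue_limits (coeff_B P) k l \<and> b = ereal (Min (l ` {..<k})))"

definition B_infty_defined :: "nat \<Rightarrow> bool"
  where "B_infty_defined P \<longleftrightarrow> (\<exists>b. has_B_infty P b)"

definition B_infty :: "nat \<Rightarrow> ereal"
  where "B_infty P = (THE b. has_B_infty P b)"

text \<open>The value of \<open>B_infty\<close> does not depend on the choice of the modulus \<open>k\<close>, and the two
  clauses of \<open>has_B_infty\<close> exclude each other, so the description above is legitimate.\<close>

lemma residue_subseq:
  fixes X :: "nat \<Rightarrow> real"
  assumes "has_residue_limits X k l" "j < k" "r \<ge> 1"
  shows "(\<lambda>m. X (j + m * (k * r))) \<longlonglongrightarrow> l j"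
proof -
  have "(\<lambda>m. X (j + m * k)) \<longlonglongrightarrow> l j"
    using assms(1,2) by (simp add: has_residue_limits_def)
  moreover have "strict_mono (\<lambda>m. m * r)"
    using assms(3) by (simp add: strict_mono_def)
  ultimately have "((\<lambda>m. X (j + m * k)) \<circ> (\<lambda>m. m * r)) \<longlonglongrightarrow> l j"
    by (rule LIMSEQ_subseq_LIMSEQ)
  then show ?thesis
    by (simp add: o_def mult_ac)
qed

lemma residue_limits_subset:
  fixes X :: "nat \<Rightarrow> real"
  assumes k: "has_residue_limits X k l" and k': "has_residue_limits X k' l'"
  shows "l ` {..<k} \<subseteq> l' ` {..<k'}"
proof
  fix x assume "x \<in> l ` {..<k}"
  then obtain j where j: "j < k" "x = l j" by auto
  have pos: "k \<ge> 1" "k' \<ge> 1"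
    using k k' by (simp_all add: has_residue_limits_def)
  have "(\<lambda>m. X (j mod k' + m * k')) \<longlonglongrightarrow> l' (j mod k')"
    using k' pos by (simp add: has_residue_limits_def)
  moreover have "strict_mono (\<lambda>m. j div k' + m * k)"
    using pos by (simp add: strict_mono_def)
  ultimately have "((\<lambda>m. X (j mod k' + m * k')) \<circ> (\<lambda>m. j div k' + m * k)) \<longlonglongrightarrow> l' (j mod k')"
    by (rule LIMSEQ_subseq_LIMSEQ)
  moreover have "j mod k' + (j div k' + m * k) * k' = j + m * (k * k')" for m
    by (simp add: algebra_simps)
  ultimately have "(\<lambda>m. X (j + m * (k * k'))) \<longlonglongrightarrow> l' (j mod k')"
    by (simp add: o_def)
  moreover have "(\<lambda>m. X (j + m * (k * k'))) \<longlonglongrightarrow> l j"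
    using residue_subseq[OF k j(1) pos(2)] .
  ultimately have "l j = l' (j mod k')"
    using LIMSEQ_unique by blast
  then show "x \<in> l' ` {..<k'}"
    using j pos by auto
qed

lemma residue_limits_not_at_top:
  fixes X :: "nat \<Rightarrow> real"
  assumes "has_residue_limits X k l"
  shows "\<not> filterlim X at_top sequentially"
proof
  assume X: "filterlim X at_top sequentially"
  have k: "k \<ge> 1" and lim: "(\<lambda>m. X (0 + m * k)) \<longlonglongrightarrow> l 0"
    using assms by (auto simp: has_residue_limits_def)
  have "filterlim (\<lambda>m. 0 + m * k) sequentially sequentially"
    by (rule filterlim_subseq) (use k in \<open>simp add: strict_mono_def\<close>)
  then have "filterlim (\<lambda>m. X (0 + m * k)) at_top sequentially"
    by (rule filterlim_compose[OF X])
  then have "filterlim (\<lambda>m. X (0 + m * k)) at_infinity sequentially"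
    by (rule filterlim_at_top_imp_at_infinity)
  with lim show False
    by (rule not_tendsto_and_filterlim_at_infinity[OF trivial_limit_sequentially])
qed

lemma has_B_infty_unique:
  assumes "has_B_infty P b" "has_B_infty P b'"
  shows "b = b'"
proof -
  have at_top: "\<not> filterlim (coeff_B P) at_top sequentially"
    if "has_residue_limits (coeff_B P) k l" for k l
    using residue_limits_not_at_top[OF that] .
  have "Min (l ` {..<k}) = Min (l' ` {..<k'})"
    if "has_residue_limits (coeff_B P) k l" "has_residue_limits (coeff_B P) k' l'" for k l k' l'
    using residue_limits_subset[OF that] residue_limits_subset[OF that(2,1)] by simp
  then show ?thesis
    using assms at_top unfolding has_B_infty_def by blast
qed

lemma B_infty_eq: "has_B_infty P b \<Longrightarrow> B_infty P = b"
  unfolding B_infty_def by (rule the_equality) (auto intro: has_B_infty_unique)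

text \<open>With the conventions of \<open>ereal\<close>: \<open>\<infinity> * real P = \<infinity>\<close> for \<open>P > 0\<close>, and \<open>x + \<infinity> = \<infinity>\<close>.\<close>

definition T_infty :: "nat \<Rightarrow> ereal"
  where "T_infty P = A_infty P * ereal (real P) + B_infty P"

text \<open>Belonging to a type includes that the coefficients it refers to are defined.\<close>

definition type_A0_minus :: "nat \<Rightarrow> bool"
  where "type_A0_minus P \<longleftrightarrow> A_infty_defined P \<and> A_infty P = 0"

definition type_A1_minus :: "nat \<Rightarrow> bool"
  where "type_A1_minus P \<longleftrightarrow> A_infty_defined P \<and> 0 < A_infty P \<and> A_infty P < 1"

definition type_A_plus :: "nat \<Rightarrow> bool"
  where "type_A_plus P \<longleftrightarrow> A_infty_defined P \<and> A_infty P > 1"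

definition type_B_minus :: "nat \<Rightarrow> bool"
  where "type_B_minus P \<longleftrightarrow> B_infty_defined P \<and> \<bar>B_infty P\<bar> \<noteq> \<infinity>"

definition type_B_plus :: "nat \<Rightarrow> bool"
  where "type_B_plus P \<longleftrightarrow> B_infty_defined P \<and> B_infty P = \<infinity>"

definition type_S_minus :: "nat \<Rightarrow> bool"
  where "type_S_minus P \<longleftrightarrow>
    A_infty_defined P \<and> B_infty_defined P \<and> T_infty P \<le> ereal (real (collatz P))"

definition type_S_plus :: "nat \<Rightarrow> bool"
  where "type_S_plus P \<longleftrightarrow>
    A_infty_defined P \<and> B_infty_defined P \<and> T_infty P > ereal (real (collatz P))"

text \<open>An infinite Collatz sequence of type \<open>R\<close> is represented by its first term.\<close>

definition realizable :: "nat set"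
  where "realizable = {P. P \<ge> 1}"

end

theory Submission
  imports Defs
begin

text \<open>
  Each step of the Collatz map multiplies \<open>A\<^sub>n\<close> by \<open>1/2\<close> or \<open>3/2\<close>, so \<open>A\<^sub>n\<close> always moves by exactly
  half of its own value. Such a sequence cannot settle at a positive real number: its limit, if
  there is one, is \<open>0\<close> or \<open>\<infinity>\<close> (\<open>A_infty_zero_or_infinite\<close>). This disposes of every category with
  \<open>0 < A\<^sub>\<infinity> < 1\<close> and reduces \<open>A\<^sub>\<infinity> > 1\<close> to \<open>A\<^sub>\<infinity> = \<infinity>\<close>.

  The quotient \<open>B\<^sub>n / A\<^sub>n\<close> never decreases, and it becomes positive at the first odd term. If
  \<open>A\<^sub>n\<close> tends to infinity an odd term must occur, so \<open>B\<^sub>n\<close> is eventually at least a positive multiple of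
  \<open>A\<^sub>n\<close> and tends to infinity as well (\<open>B_infty_infinite_if_A_infty_infinite\<close>). Hence \<open>A\<^sub>\<infinity> > 1\<close> excludes a
  finite \<open>B\<^sub>\<infinity>\<close>.

  Finally, \<open>B\<^sub>\<infinity> = \<infinity>\<close> forces \<open>T\<^sup>\<infinity>(P) = \<infinity> > T(P)\<close>, which excludes the categories that combine
  \<open>S\<^sup>-\<close> with \<open>B\<^sup>+\<close>.
\<close>

lemma coeff_A_pos: "coeff_A P n > 0"
  by (simp add: coeff_A_def)

lemma coeff_B_nonneg: "coeff_B P n \<ge> 0"
  by (induction n) (simp_all add: coeff_0 coeff_B_Suc)

lemma coeff_A_step: "\<bar>coeff_A P (Suc n) - coeff_A P n\<bar> = coeff_A P n / 2"
  using coeff_A_pos[of P n] by (simp add: coeff_A_Suc i0_def)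

text \<open>At a finite limit the increments tend to \<open>0\<close>; as they are half of the terms in absolute
  value, the limit itself is \<open>0\<close>.\<close>

lemma A_infty_zero_or_infinite:
  assumes "A_infty_defined P"
  shows "A_infty P = 0 \<or> A_infty P = \<infinity>"
proof -
  have lim: "(\<lambda>n. ereal (coeff_A P n)) \<longlonglongrightarrow> A_infty P"
    using assms by (simp add: A_infty_defined_def A_infty_def convergent_LIMSEQ_iff)
  have nonneg: "0 \<le> A_infty P"
    by (rule LIMSEQ_le_const[OF lim]) (auto intro: less_imp_le[OF coeff_A_pos])
  show ?thesis
  proof (cases "A_infty P")
    case (real a)
    then have a: "coeff_A P \<longlonglongrightarrow> a"
      using lim by simp
    have "(\<lambda>n. \<bar>coeff_A P (Suc n) - coeff_A P n\<bar>) \<longlonglongrightarrow> \<bar>a - a\<bar>"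
      by (intro tendsto_intros a LIMSEQ_Suc)
    then have "(\<lambda>n. coeff_A P n / 2) \<longlonglongrightarrow> 0"
      by (simp add: coeff_A_step)
    moreover have "(\<lambda>n. coeff_A P n / 2) \<longlonglongrightarrow> a / 2"
      by (intro tendsto_intros a) simp
    ultimately have "a / 2 = 0"
      by (rule LIMSEQ_unique[rotated])
    with real show ?thesis by (simp add: zero_ereal_def)
  qed (use nonneg in auto)
qed

text \<open>Both coefficients are multiplied by the same factor at each step, and only \<open>B\<^sub>n\<close> gains a
  nonnegative term.\<close>

lemma coeff_B_over_A_mono: "mono (\<lambda>n. coeff_B P n / coeff_A P n)"
proof (rule incseq_SucI)
  fix n
  show "coeff_B P n / coeff_A P n \<le> coeff_B P (Suc n) / coeff_A P (Suc n)"
    using coeff_A_pos[of P n] by (simp add: coeff_A_Suc coeff_B_Suc i0_def field_simps)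
qed

lemma B_infty_infinite_if_A_infty_infinite:
  assumes "A_infty_defined P" "A_infty P = \<infinity>"
  shows "B_infty P = \<infinity>"
proof -
  have "(\<lambda>n. ereal (coeff_A P n)) \<longlonglongrightarrow> \<infinity>"
    using assms by (simp add: A_infty_defined_def A_infty_def convergent_LIMSEQ_iff)
  then have A: "filterlim (coeff_A P) at_top sequentially"
    by (simp add: tendsto_PInfty_eq_at_top)
  have "\<exists>j. odd ((collatz ^^ j) P)"
  proof (rule ccontr)
    assume "\<nexists>j. odd ((collatz ^^ j) P)"
    \<comment> \<open>Without odd terms the sequence is \<open>A\<^sub>n = 1/2\<^sup>n\<close>.\<close>
    then have "coeff_A P n \<le> 1" for n
      by (simp add: coeff_A_def)
    moreover obtain n where "coeff_A P n \<ge> 2"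
      using A by (auto simp: filterlim_at_top eventually_sequentially)
    ultimately show False
      by (metis order_trans one_le_numeral numeral_le_one_iff semiring_norm(69))
  qed
  then obtain j where "odd ((collatz ^^ j) P)" ..
  then have "coeff_B P (Suc j) > 0"
    using coeff_B_nonneg[of P j] by (simp add: coeff_B_Suc i0_def)
  define c where "c = coeff_B P (Suc j) / coeff_A P (Suc j)"
  have "c > 0"
    using \<open>coeff_B P (Suc j) > 0\<close> coeff_A_pos by (simp add: c_def)
  have "c * coeff_A P n \<le> coeff_B P n" if "Suc j \<le> n" for n
    using monoD[OF coeff_B_over_A_mono that, of P] coeff_A_pos[of P n]
    by (simp add: c_def pos_le_divide_eq)
  then have "\<forall>\<^sub>F n in sequentially. c * coeff_A P n \<le> coeff_B P n"
    by (auto simp: eventually_sequentially)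
  moreover have "filterlim (\<lambda>n. c * coeff_A P n) at_top sequentially"
    by (rule filterlim_tendsto_pos_mult_at_top[OF tendsto_const \<open>c > 0\<close> A])
  ultimately have "filterlim (coeff_B P) at_top sequentially"
    by (rule filterlim_at_top_mono[rotated])
  then show ?thesis
    by (intro B_infty_eq) (simp add: has_B_infty_def)
qed

lemma not_type_A1_minus: "\<not> type_A1_minus P"
  using A_infty_zero_or_infinite[of P] by (auto simp: type_A1_minus_def)

lemma not_type_A_plus_B_minus: "\<not> (type_A_plus P \<and> type_B_minus P)"
  using A_infty_zero_or_infinite[of P] B_infty_infinite_if_A_infty_infinite[of P]
  by (auto simp: type_A_plus_def type_B_minus_def)

lemma not_type_S_minus_B_plus: "\<not> (type_S_minus P \<and> type_B_plus P)"
  by (auto simp: type_S_minus_def type_B_plus_def T_infty_def)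

theorem proposition5p1:
  shows "{P \<in> realizable. type_S_minus P \<and> type_A0_minus P \<and> type_B_plus P} = {}
    \<and> {P \<in> realizable. type_S_minus P \<and> type_A1_minus P \<and> type_B_minus P} = {}
    \<and> {P \<in> realizable. type_S_plus P \<and> type_A1_minus P \<and> type_B_minus P} = {}
    \<and> {P \<in> realizable. type_S_minus P \<and> type_A1_minus P \<and> type_B_plus P} = {}
    \<and> {P \<in> realizable. type_S_minus P \<and> type_A_plus P \<and> type_B_minus P} = {}
    \<and> {P \<in> realizable. type_S_minus P \<and> type_A_plus P \<and> type_B_plus P} = {}
    \<and> {P \<in> realizable. type_S_plus P \<and> type_A_plus P \<and> type_B_minus P} = {}"
  using not_type_A1_minus not_type_A_plus_B_minus not_type_S_minus_B_plus by blast

end
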